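(* For every $\varepsilon\in(0,1)$ and $\delta>0$ there is an $L$ such that for all $\ell\ge L$ and all integers $t\ge \frac{48+\delta}{\pi^2}\,\ell^4\log\ell$, the Luby-Randall-Sinclair lozenge tiling Markov chain on the regular hexagon of side length $\ell$ satisfies $d(t)\le\varepsilon$. (That is, its mixing time is at most $\frac{48+o(1)}{\pi^2}\ell^4\log\ell$.)
   Context: Consider the triangular lattice of unit equilateral triangles with one family of edges vertical, and the regular hexagon with side length $\ell$ (two of its sides vertical). A lozenge is a union of two triangles sharing an edge. In the lattice path representation, lozenge tilings of the hexagon correspond bijectively to families of $\ell$ nonintersecting (vertex-disjoint) lattice paths, each having $2\ell$ steps moving by $1$ horizontally and $\pm\frac12$ vertically ($\ell$ steps up and $\ell$ steps down), with the $\ell$ paths starting at $\ell$ vertically consecutive points (spaced by 1) on the left side and ending at the corresponding $\ell$ points on the right side. Write $h_i(x)$ for the height of path $i$ at horizontal coordinate $x$. Luby-Randall-Sinclair chain: at each step choose uniformly one of the internal (non-endpoint) points on the paths, say on path $i$ at coordinate $x$, and choose up or down with probability $1/2$ each. If the direction is up and path $i$ has a local minimum at $x$ ($h_i(x\pm1)=h_i(x)+\frac12$), let $k\ge0$ be the smallest integer such that the point at coordinate $x$ and height $h_i(x)+k+1$ is not on any path (so $k$ paths block the move); with probability $1/(k+1)$ the heights at $x$ of path $i$ and of the $k$ blocking paths above it are all raised by 1, and otherwise nothing changes. Pushing down a local maximum is defined symmetrically. In all other cases nothing changes. The stationary distribution $U$ is uniform. $d(t)=\max_x\|P_x^t-U\|_{TV}$,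 where $P_x^t$ is the law at time $t$ of the chain started from state $x$ and $\|\cdot\|_{TV}=\frac12\|\cdot\|_1$. $\log$ is the natural logarithm. *)

theory Defs
  imports "HOL-Probability.Probability"
begin

text \<open>
  A lozenge tiling of the regular hexagon of side \<open>n\<close> is represented by its family of lattice
  paths: \<open>h i x\<close> is the height of path \<open>i\<close> (\<open>0 \<le> i < n\<close>, from bottom to top) at horizontal
  coordinate \<open>x\<close> (\<open>0 \<le> x \<le> 2 * n\<close>). The origin of heights is the lowest starting point.
  Outside this index range \<open>h\<close> is fixed to \<open>0\<close>, so that equality of functions is equality of
  path families.
\<close>

definition path_families :: "nat \<Rightarrow> (nat \<Rightarrow> nat \<Rightarrow> real) set" where
  "path_families n = {h.
     (\<forall>i<n. h i 0 = real i \<and> h i (2 * n) = real i) \<and>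
     (\<forall>i<n. \<forall>x<2 * n. h i (x + 1) = h i x + 1/2 \<or> h i (x + 1) = h i x - 1/2) \<and>
     (\<forall>x\<le>2 * n. \<forall>i<n. \<forall>j<n. i \<noteq> j \<longrightarrow> h i x \<noteq> h j x) \<and>
     (\<forall>i x. \<not> (i < n \<and> x \<le> 2 * n) \<longrightarrow> h i x = 0)}"

definition internal_points :: "nat \<Rightarrow> (nat \<times> nat) set" where
  "internal_points n = {(i, x). i < n \<and> 0 < x \<and> x < 2 * n}"

text \<open>
  The direction of a push is a sign \<open>s\<close>: \<open>s = 1\<close> is up and \<open>s = -1\<close> is down. Path \<open>i\<close> can be
  pushed at \<open>x\<close> if it has a local minimum (\<open>s = 1\<close>) or a local maximum (\<open>s = -1\<close>) there.
\<close>

definition pushable :: "real \<Rightarrow> (nat \<Rightarrow> nat \<Rightarrow> real) \<Rightarrow> nat \<Rightarrow> nat \<Rightarrow> bool" where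
  "pushable s h i x \<longleftrightarrow> h i (x - 1) = h i x + s / 2 \<and> h i (x + 1) = h i x + s / 2"

definition num_blocking :: "nat \<Rightarrow> real \<Rightarrow> (nat \<Rightarrow> nat \<Rightarrow> real) \<Rightarrow> nat \<Rightarrow> nat \<Rightarrow> nat" where
  "num_blocking n s h i x = (LEAST k. \<forall>j<n. h j x \<noteq> h i x + s * (real k + 1))"

text \<open>The paths moved by a push: path \<open>i\<close> itself (\<open>m = 0\<close>) and the paths blocking it.\<close>

definition pushed_paths :: "nat \<Rightarrow> real \<Rightarrow> (nat \<Rightarrow> nat \<Rightarrow> real) \<Rightarrow> nat \<Rightarrow> nat \<Rightarrow> nat set" where
  "pushed_paths n s h i x =
     {j. j < n \<and> (\<exists>m\<le>num_blocking n s h i x. h j x = h i x + s * real m)}"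

definition push :: "nat \<Rightarrow> real \<Rightarrow> (nat \<Rightarrow> nat \<Rightarrow> real) \<Rightarrow> nat \<Rightarrow> nat \<Rightarrow> (nat \<Rightarrow> nat \<Rightarrow> real)" where
  "push n s h i x =
     (\<lambda>j y. if j \<in> pushed_paths n s h i x \<and> y = x then h j y + s else h j y)"

definition LRS_step :: "nat \<Rightarrow> (nat \<Rightarrow> nat \<Rightarrow> real) \<Rightarrow> (nat \<Rightarrow> nat \<Rightarrow> real) pmf" where
  "LRS_step n h =
     bind_pmf (pmf_of_set (internal_points n)) (\<lambda>(i, x).
     bind_pmf (pmf_of_set {1, - 1}) (\<lambda>s.
       if pushable s h i x
       then map_pmf (\<lambda>accept. if accept then push n s h i x else h)
              (bernoulli_pmf (1 / (real (num_blocking n s h i x) + 1)))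
       else return_pmf h))"

definition LRS_law :: "nat \<Rightarrow> (nat \<Rightarrow> nat \<Rightarrow> real) \<Rightarrow> nat \<Rightarrow> (nat \<Rightarrow> nat \<Rightarrow> real) pmf" where
  "LRS_law n h t = ((\<lambda>p. bind_pmf p (LRS_step n)) ^^ t) (return_pmf h)"

definition tv_dist :: "'a pmf \<Rightarrow> 'a pmf \<Rightarrow> real" where
  "tv_dist p q = (1/2) * (\<Sum>\<^sub>\<infinity>y. \<bar>pmf p y - pmf q y\<bar>)"

definition LRS_distance :: "nat \<Rightarrow> nat \<Rightarrow> real" where
  "LRS_distance n t =
     (MAX h\<in>path_families n. tv_dist (LRS_law n h t) (pmf_of_set (path_families n)))"

text \<open>
  The uniform distribution and the maximum above are meaningful because the state space is
  finite and nonempty.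
\<close>

lemma path_families_nonempty: "path_families n \<noteq> {}"
proof -
  define h :: "nat \<Rightarrow> nat \<Rightarrow> real" where
    "h = (\<lambda>i x. if i < n \<and> x \<le> 2 * n then real i + (if even x then 0 else 1/2) else 0)"
  have "h \<in> path_families n"
    unfolding path_families_def h_def by auto
  then show ?thesis by blast
qed

lemma path_families_finite: "finite (path_families n)"
proof -
  define B :: "real set" where "B = (\<lambda>k::int. of_int k / 2) ` {- 2 * int n..4 * int n}"
  define g :: "(nat \<Rightarrow> nat \<Rightarrow> real) \<Rightarrow> nat \<times> nat \<Rightarrow> real" where "g = (\<lambda>h (i, x). h i x)"
  have val: "\<exists>k::int. h i x = of_int k / 2 \<and> - int x \<le> k \<and> k \<le> 2 * int i + int x"
    if h: "h \<in> path_families n" and i: "i < n" and "x \<le> 2 * n" for h i x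
    using \<open>x \<le> 2 * n\<close>
  proof (induction x)
    case 0
    have "h i 0 = of_int (2 * int i) / 2"
      using h i by (simp add: path_families_def)
    then show ?case by (intro exI[of _ "2 * int i"]) simp
  next
    case (Suc x)
    then obtain k :: int where k: "h i x = of_int k / 2" "- int x \<le> k" "k \<le> 2 * int i + int x"
      by auto
    have "h i (x + 1) = h i x + 1/2 \<or> h i (x + 1) = h i x - 1/2"
      using h i Suc.prems unfolding path_families_def by auto
    then show ?case
    proof
      assume "h i (x + 1) = h i x + 1/2"
      then show ?thesis using k by (intro exI[of _ "k + 1"]) (auto simp: field_simps)
    next
      assume "h i (x + 1) = h i x - 1/2"
      then show ?thesis using k by (intro exI[of _ "k - 1"]) (auto simp: field_simps)
    qed
  qed
  have "g h \<in> {f. \<forall>p. (p \<in> {..<n} \<times> {..2 * n} \<longrightarrow> f p \<in> B) \<and> (p \<notin> {..<n} \<times> {..2 * n} \<longrightarrow> f p = 0)}"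
    if h: "h \<in> path_families n" for h
  proof -
    have "h i x \<in> B" if "i < n" "x \<le> 2 * n" for i x
    proof -
      obtain k :: int where k: "h i x = of_int k / 2" "- int x \<le> k" "k \<le> 2 * int i + int x"
        using val[OF h \<open>i < n\<close> \<open>x \<le> 2 * n\<close>] by blast
      moreover have "k \<in> {- 2 * int n..4 * int n}" using k that by auto
      ultimately show ?thesis unfolding B_def by blast
    qed
    moreover have "h i x = 0" if "\<not> (i < n \<and> x \<le> 2 * n)" for i x
      using h that unfolding path_families_def by blast
    ultimately show ?thesis unfolding g_def by auto
  qed
  moreover have "finite {f. \<forall>p. (p \<in> {..<n} \<times> {..2 * n} \<longrightarrow> f p \<in> B) \<and> (p \<notin> {..<n} \<times> {..2 * n} \<longrightarrow> f p = 0)}"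
    by (rule finite_set_of_finite_funs) (auto simp: B_def)
  ultimately have "finite (g ` path_families n)"
    by (meson finite_subset image_subsetI)
  moreover have "inj_on g (path_families n)"
  proof (rule inj_onI)
    fix h h' assume eq: "g h = g h'"
    have "h i x = h' i x" for i x
      using fun_cong[OF eq, of "(i, x)"] by (simp add: g_def)
    then show "h = h'" by blast
  qed
  ultimately show ?thesis by (rule finite_imageD)
qed

end

theory Submission
  imports Defs "HOL-Real_Asymp.Real_Asymp"
begin

text \<open>
  Moving a tower of \<open>k + 1\<close> paths with probability \<open>1 / (k + 1)\<close> makes the expected heights evolve
  by the discrete heat equation, exactly as if paths did not block each other. Sharing the chosen
  point, the direction and the acceptance variable gives a monotone coupling, so all copies of the
  chain have met once the copies started from the highest and the lowest family have met. The area
  between these two, weighted by \<open>cos (\<theta> (x - n) / n)\<close> with \<open>\<theta>\<close> slightly below \<open>pi / 2\<close>, shrinks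
  in expectation by a factor of about \<open>1 - \<theta>\<^sup>2 / (4 n\<^sup>4)\<close> per step, is of order \<open>n\<^sup>3\<close> at the start
  and is at least \<open>cos \<theta>\<close> as long as the two families differ.
\<close>

section \<open>Geometry of path families and pushes\<close>

text \<open>The heat equation holds only for the column sums of the heights: a single path also
  moves when it blocks another one, and only in the sum over all paths does the tower size
  \<open>k + 1\<close> cancel the acceptance probability. The constant arises as follows. There are
  \<open>n * (2 * n - 1)\<close> points, a direction has probability 1/2, and the Laplacian
  contributes \<open>2 * (1 - cos (\<theta> / n))\<close>. Bringing an area of order
  \<open>n^3\<close> below a constant takes about \<open>3 * 4 * n^4 * ln n / \<theta>^2\<close>
  steps, and \<open>\<theta>\<close> near \<open>pi / 2\<close> turns 12 into
  \<open>48 / pi^2\<close>. Since \<open>\<theta>\<close> is fixed before \<open>n\<close> grows,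
  \<open>1 / cos \<theta>\<close> is a constant. The obstacle to monotonicity is that two copies may
  see different numbers of blocking paths at the same point and so accept with different
  probabilities. Distance to the uniform law also requires its stationarity, which comes from
  pairing each push with its reversal.\<close>

lemma path_families_step:
  assumes "h \<in> path_families n" "i < n" "x < 2 * n"
  shows "h i (Suc x) = h i x + 1/2 \<or> h i (Suc x) = h i x - 1/2"
  using assms unfolding path_families_def by auto

lemma path_families_step':
  assumes "h \<in> path_families n" "i < n" "0 < x" "x \<le> 2 * n"
  shows "h i (x - Suc 0) = h i x + 1/2 \<or> h i (x - Suc 0) = h i x - 1/2"
  using path_families_step[OF assms(1,2), of "x - 1"] assms(3,4) by (auto simp: field_simps)

text \<open>All families share one coset of the integers in column \<open>x\<close>. This turns
  every strict inequality of heights, also between different families, into a gap of at least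
  1.\<close>

lemma path_families_parity:
  assumes "h \<in> path_families n" "i < n" "x \<le> 2 * n"
  shows "\<exists>k::int. h i x = real x / 2 + of_int k"
  using assms(3)
proof (induction x)
  case 0
  have "h i 0 = of_int (int i)"
    using assms by (simp add: path_families_def)
  then show ?case by (intro exI[of _ "int i"]) simp
next
  case (Suc x)
  then obtain k :: int where k: "h i x = real x / 2 + of_int k"
    by auto
  from path_families_step[OF assms(1,2), of x] Suc.prems
  consider "h i (Suc x) = h i x + 1/2" | "h i (Suc x) = h i x - 1/2"
    by auto
  then show ?case
  proof cases
    case 1
    then show ?thesis using k by (intro exI[of _ k]) (auto simp: field_simps)
  next
    case 2
    then show ?thesis using k by (intro exI[of _ "k - 1"]) (auto simp: field_simps)
  qed
qed

lemma path_families_diff_less: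
  assumes "h \<in> path_families n" "g \<in> path_families n" "i < n" "j < n" "x \<le> 2 * n"
    and "h i x < g j x"
  shows "h i x + 1 \<le> g j x"
proof -
  obtain k l :: int where "h i x = real x / 2 + of_int k" "g j x = real x / 2 + of_int l"
    using path_families_parity assms by metis
  with assms(6) show ?thesis by simp
qed

lemma path_families_inj:
  assumes "h \<in> path_families n" "i < n" "j < n" "x \<le> 2 * n" "h i x = h j x"
  shows "i = j"
  using assms unfolding path_families_def by blast

text \<open>Two paths at distance at least 1 approach each other by at most 1 per step, so they
  could meet but not cross, and disjointness excludes meeting.\<close>

lemma path_families_less:
  assumes "h \<in> path_families n" "i < j" "j < n" "x \<le> 2 * n"
  shows "h i x + 1 \<le> h j x"
  using assms(4)
proof (induction x)
  case 0
  then show ?case using assms by (simp add: path_families_def)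
next
  case (Suc x)
  then have IH: "h i x + 1 \<le> h j x" by simp
  have "h i (Suc x) \<le> h j (Suc x)"
    using path_families_step[OF assms(1), of i x] path_families_step[OF assms(1), of j x]
      IH Suc.prems assms by auto
  moreover have "h i (Suc x) \<noteq> h j (Suc x)"
    using path_families_inj[OF assms(1)] assms Suc.prems by (metis less_irrefl less_trans)
  ultimately show ?case
    using path_families_diff_less[OF assms(1,1)] assms Suc.prems by simp
qed

lemma path_families_gap:
  assumes "h \<in> path_families n" "i + m < n" "x \<le> 2 * n"
  shows "h i x + real m \<le> h (i + m) x"
  using assms(2)
proof (induction m)
  case (Suc m)
  then show ?case
    using path_families_less[OF assms(1), of "i + m" "i + Suc m" x] assms by simp
qed simp

text \<open>Both directions of a push are treated at once by multiplying heights by the sign \<open>s\<close>.\<close>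

lemma path_families_signed_gap:
  fixes s :: real
  assumes "s \<in> {1, - 1}" "h \<in> path_families n" "i < n" "j < n" "x \<le> 2 * n"
    and "real j = real i + s * real m"
  shows "s * h i x + real m \<le> s * h j x"
proof (cases "s = 1")
  case True
  then have "j = i + m" using assms by simp
  then show ?thesis using path_families_gap[of h n i m x] assms True by simp
next
  case False
  then have "i = j + m" using assms by simp
  then show ?thesis using path_families_gap[of h n j m x] assms False by simp
qed

lemma signed_offset:
  fixes s :: real
  assumes "s \<in> {1, - 1}" "h \<in> path_families n" "i < n" "j < n" "x \<le> 2 * n"
    and "s * h i x \<le> s * h j x"
  shows "\<exists>m. real j = real i + s * real m"
proof (cases "s = 1")
  case True
  then have "\<not> j < i" using path_families_less[of h n j i x] assms by auto
  then show ?thesis using True by (intro exI[of _ "j - i"]) auto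
next
  case False
  then have "\<not> i < j" using path_families_less[of h n i j x] assms by auto
  then show ?thesis using False assms(1) by (intro exI[of _ "i - j"]) auto
qed

text \<open>An index difference \<open>l\<close> forces a height difference of at least
  \<open>l\<close>, so a path exactly one unit further on must have the neighbouring index. Hence a
  tower has consecutive indices and consecutive heights.\<close>

lemma num_blocking_occupied:
  assumes s: "s \<in> {1, - 1}" and h: "h \<in> path_families n" and ix: "i < n" "x \<le> 2 * n"
    and "m \<le> num_blocking n s h i x"
  shows "\<exists>j<n. real j = real i + s * real m \<and> h j x = h i x + s * real m"
  using assms(5)
proof (induction m)
  case 0
  then show ?case using ix by auto
next
  case (Suc m)
  then obtain j where j: "j < n" "real j = real i + s * real m" "h j x = h i x + s * real m"
    by auto
  have "m < num_blocking n s h i x" using Suc.prems by simp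
  then obtain j' where j': "j' < n" "h j' x = h i x + s * (real m + 1)"
    unfolding num_blocking_def using not_less_Least by blast
  have le: "s * h j x \<le> s * h j' x" using j(3) j'(2) s by auto
  then obtain l where l: "real j' = real j + s * real l"
    using signed_offset[OF s h j(1) j'(1) ix(2)] by blast
  have "s * h j x + real l \<le> s * h j' x"
    using path_families_signed_gap[OF s h j(1) j'(1) ix(2) l] .
  then have "real l \<le> 1" using j(3) j'(2) s by auto
  moreover have "l \<noteq> 0"
  proof
    assume "l = 0"
    then have "j' = j" using l by simp
    then show False using j(3) j'(2) s by auto
  qed
  ultimately have "l = 1" by simp
  then show ?case using j j' l by (intro exI[of _ j']) (simp add: algebra_simps)
qed

text \<open>Only finitely many heights are occupied in a column, so the \<open>LEAST\<close> in the
  definition is attained.\<close>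

lemma num_blocking_free:
  assumes s: "s \<in> {1, - 1}" and "j < n"
  shows "h j x \<noteq> h i x + s * (real (num_blocking n s h i x) + 1)"
proof -
  have "\<exists>k. \<forall>j<n. h j x \<noteq> h i x + s * (real k + 1)"
  proof (rule ccontr)
    assume "\<nexists>k. \<forall>j<n. h j x \<noteq> h i x + s * (real k + 1)"
    then have "\<exists>j<n. h j x = h i x + s * (real k + 1)" for k by blast
    then have "\<exists>j<n. real k = s * (h j x - h i x) - 1" for k
      using s by (metis (no_types, lifting) add_diff_cancel_left' add_diff_cancel_right'
          insertE minus_diff_eq mult.left_commute mult_1 mult_minus1 singletonD)
    then have "range real \<subseteq> (\<lambda>j. s * (h j x - h i x) - 1) ` {..<n}" by blast
    then have "finite (range real)" using finite_surj by blast
    then show False using finite_imageD inj_of_nat infinite_UNIV_nat by blast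
  qed
  then have "\<forall>j<n. h j x \<noteq> h i x + s * (real (num_blocking n s h i x) + 1)"
    unfolding num_blocking_def by (rule LeastI_ex)
  then show ?thesis using assms by blast
qed

lemma num_blocking_less:
  assumes s: "s \<in> {1, - 1}" and h: "h \<in> path_families n" and ix: "i < n" "x \<le> 2 * n"
  shows "num_blocking n s h i x < n"
  using num_blocking_occupied[OF assms order_refl] s ix by force

lemma num_blocking_eqI:
  assumes "\<And>m. m < k \<Longrightarrow> \<exists>j<n. h j x = h i x + s * (real m + 1)"
    and "\<And>j. j < n \<Longrightarrow> h j x \<noteq> h i x + s * (real k + 1)"
  shows "num_blocking n s h i x = k"
  unfolding num_blocking_def
  by (rule Least_equality) (use assms in \<open>auto simp: not_less[symmetric]\<close>)

lemma pushed_paths_iff: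
  assumes s: "s \<in> {1, - 1}" and h: "h \<in> path_families n" and ix: "i < n" "x \<le> 2 * n"
  shows "j \<in> pushed_paths n s h i x \<longleftrightarrow>
    j < n \<and> (\<exists>m\<le>num_blocking n s h i x. real j = real i + s * real m \<and> h j x = h i x + s * real m)"
    (is "?L \<longleftrightarrow> ?R")
proof
  assume ?L
  then obtain m where m: "m \<le> num_blocking n s h i x" "h j x = h i x + s * real m" and "j < n"
    unfolding pushed_paths_def by blast
  moreover obtain j' where "j' < n" "real j' = real i + s * real m" "h j' x = h i x + s * real m"
    using num_blocking_occupied[OF assms m(1)] by blast
  moreover have "j' = j" using path_families_inj[OF h] calculation ix by metis
  ultimately show ?R by blast
next
  assume ?R
  then show ?L unfolding pushed_paths_def by blast
qed

text \<open>Within the tower the index offset already determines the height. This lets the towers of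
  two families be compared by index.\<close>

lemma pushed_paths_iff_offset:
  assumes s: "s \<in> {1, - 1}" and h: "h \<in> path_families n" and ix: "i < n" "x \<le> 2 * n"
  shows "j \<in> pushed_paths n s h i x \<longleftrightarrow>
    j < n \<and> (\<exists>m\<le>num_blocking n s h i x. real j = real i + s * real m)"
proof -
  have "h j x = h i x + s * real m"
    if "m \<le> num_blocking n s h i x" "real j = real i + s * real m" for m
    using num_blocking_occupied[OF assms that(1)] that(2) by (metis of_nat_eq_iff)
  then show ?thesis using pushed_paths_iff[OF assms] by blast
qed

lemma card_pushed_paths:
  assumes s: "s \<in> {1, - 1}" and h: "h \<in> path_families n" and ix: "i < n" "x \<le> 2 * n"
  shows "card (pushed_paths n s h i x) = num_blocking n s h i x + 1"
proof -
  \<comment> \<open>As \<open>s\<close> is its own inverse, this recovers the offset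
    \<open>m\<close> from \<open>j = i + s * m\<close>.\<close>
  let ?f = "\<lambda>j. nat \<lfloor>s * (real j - real i)\<rfloor>"
  have val: "?f j = m" if "real j = real i + s * real m" for j m
    using that s by auto
  have "bij_betw ?f (pushed_paths n s h i x) {..num_blocking n s h i x}"
  proof (rule bij_betw_imageI)
    show "inj_on ?f (pushed_paths n s h i x)"
    proof (rule inj_onI)
      fix j j' assume *: "j \<in> pushed_paths n s h i x" "j' \<in> pushed_paths n s h i x" "?f j = ?f j'"
      then obtain m m' where "real j = real i + s * real m" "real j' = real i + s * real m'"
        using pushed_paths_iff_offset[OF assms] by blast
      with *(3) val show "j = j'" by (metis of_nat_eq_iff)
    qed
    show "?f ` pushed_paths n s h i x = {..num_blocking n s h i x}"
    proof (intro equalityI subsetI)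
      fix m assume "m \<in> ?f ` pushed_paths n s h i x"
      then show "m \<in> {..num_blocking n s h i x}"
        using pushed_paths_iff_offset[OF assms] val by auto
    next
      fix m assume "m \<in> {..num_blocking n s h i x}"
      then obtain j where "j < n" "real j = real i + s * real m"
        using num_blocking_occupied[OF assms] by auto
      then show "m \<in> ?f ` pushed_paths n s h i x"
        using pushed_paths_iff_offset[OF assms] val \<open>m \<in> _\<close> by (intro image_eqI[of _ _ j]) auto
    qed
  qed
  then show ?thesis using bij_betw_same_card by fastforce
qed

text \<open>In the columns next to \<open>x\<close> path \<open>i\<close> is already displaced in
  direction \<open>s\<close>, and the gap condition carries this along the tower, so each blocking
  path must turn at \<open>x\<close> as well.\<close>

lemma pushed_paths_local_extremum:
  assumes s: "s \<in> {1, - 1}" and h: "h \<in> path_families n" and ix: "i < n" "0 < x" "x < 2 * n"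
    and p: "pushable s h i x" and j: "j \<in> pushed_paths n s h i x"
  shows "pushable s h j x"
proof -
  obtain m where "j < n" and m: "real j = real i + s * real m" "h j x = h i x + s * real m"
    using pushed_paths_iff[OF s h, of i x j] ix j by auto
  have "s * h i (x - 1) + real m \<le> s * h j (x - 1)" "s * h i (x + 1) + real m \<le> s * h j (x + 1)"
    using path_families_signed_gap[OF s h ix(1) \<open>j < n\<close> _ m(1)] ix by auto
  then show ?thesis
    using p m(2) path_families_step[OF h \<open>j < n\<close> ix(3)] s
      path_families_step'[OF h \<open>j < n\<close> ix(2)] ix(3)
    unfolding pushable_def by (auto simp: algebra_simps)
qed

lemma push_in_path_families:
  assumes s: "s \<in> {1, - 1}" and h: "h \<in> path_families n" and ix: "i < n" "0 < x" "x < 2 * n"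
    and p: "pushable s h i x"
  shows "push n s h i x \<in> path_families n"
proof -
  let ?P = "pushed_paths n s h i x" and ?g = "push n s h i x"
  have P: "j < n" "h j (x - 1) = h j x + s / 2" "h j (x + 1) = h j x + s / 2" if "j \<in> ?P" for j
    using pushed_paths_local_extremum[OF assms that] that
    unfolding pushable_def pushed_paths_def by auto
  have g: "?g j y = (if j \<in> ?P \<and> y = x then h j y + s else h j y)" for j y
    by (simp add: push_def)
  \<comment> \<open>A moved path could only collide with the path just beyond the tower, and that
    height is free by the choice of \<open>num_blocking\<close>.\<close>
  have new: "h j' x \<noteq> h j x + s" if j: "j \<in> ?P" and j': "j' \<notin> ?P" "j' < n" for j j'
  proof
    assume eq: "h j' x = h j x + s"
    obtain m where m: "m \<le> num_blocking n s h i x" "h j x = h i x + s * real m"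
      using j unfolding pushed_paths_def by blast
    have eq': "h j' x = h i x + s * real (Suc m)" using eq m(2) by (simp add: algebra_simps)
    show False
    proof (cases "m = num_blocking n s h i x")
      case True
      then show False using eq' num_blocking_free[OF s j'(2)] by (metis of_nat_Suc add.commute)
    next
      case False
      then have "Suc m \<le> num_blocking n s h i x" using m by simp
      then show False using eq' j' unfolding pushed_paths_def by blast
    qed
  qed
  have "?g j y \<noteq> ?g j' y" if "y \<le> 2 * n" "j < n" "j' < n" "j \<noteq> j'" for j j' y
    using path_families_inj[OF h that(2,3,1)] that new[of j j'] new[of j' j] unfolding g by auto
  moreover have "?g j (y + 1) = ?g j y + 1/2 \<or> ?g j (y + 1) = ?g j y - 1/2" if "j < n" "y < 2 * n" for j y
  proof -
    consider "j \<in> ?P" "y = x" | "j \<in> ?P" "y = x - 1" | "j \<notin> ?P \<or> (y \<noteq> x \<and> y + 1 \<noteq> x)"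
      using ix by force
    then show ?thesis
    proof cases
      case 1
      then show ?thesis using P(3)[OF 1(1)] s unfolding g by auto
    next
      case 2
      then show ?thesis using P(2)[OF 2(1)] s ix unfolding g by auto
    next
      case 3
      then show ?thesis using path_families_step[OF h that] unfolding g by auto
    qed
  qed
  moreover have "?g j 0 = real j" "?g j (2 * n) = real j" if "j < n" for j
    using h ix that unfolding g by (auto simp: path_families_def)
  moreover have "?g j y = 0" if "\<not> (j < n \<and> y \<le> 2 * n)" for j y
    using h ix that P(1)[of j] unfolding g by (auto simp: path_families_def)
  ultimately show ?thesis unfolding path_families_def by blast
qed


section \<open>Reversal of pushes\<close>

definition reverse_index :: "nat \<Rightarrow> real \<Rightarrow> (nat \<Rightarrow> nat \<Rightarrow> real) \<Rightarrow> nat \<Rightarrow> nat \<Rightarrow> nat" where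
  "reverse_index n s h i x = nat \<lfloor>real i + s * real (num_blocking n s h i x)\<rfloor>"

text \<open>A push is undone by pushing the last of the moved paths in the opposite direction, and this
  opposite push moves the same number of paths.\<close>

lemma push_reverse:
  assumes s: "s \<in> {1, - 1}" and h: "h \<in> path_families n" and ix: "i < n" "0 < x" "x < 2 * n"
    and p: "pushable s h i x"
  defines "g \<equiv> push n s h i x" and "i' \<equiv> reverse_index n s h i x"
  shows "i' < n" "pushable (- s) g i' x" "num_blocking n (- s) g i' x = num_blocking n s h i x"
    "push n (- s) g i' x = h" "reverse_index n (- s) g i' x = i"
proof -
  define k where "k = num_blocking n s h i x"
  have x: "x \<le> 2 * n" using ix by simp
  note occ = num_blocking_occupied[OF s h ix(1) x]
  note off = pushed_paths_iff_offset[OF s h ix(1) x]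
  let ?P = "pushed_paths n s h i x"
  have g: "g j y = (if j \<in> ?P \<and> y = x then h j y + s else h j y)" for j y
    by (simp add: push_def g_def)
  have gPF: "g \<in> path_families n"
    unfolding g_def using push_in_path_families assms by blast
  obtain j where j: "j < n" "real j = real i + s * real k" "h j x = h i x + s * real k"
    using occ[OF order_refl] unfolding k_def by blast
  have "i' = j"
    unfolding i'_def reverse_index_def k_def[symmetric] j(2)[symmetric] by simp
  note i' = j[folded this]
  then show "i' < n" by simp
  have i'P: "i' \<in> ?P" using i' off unfolding k_def by blast
  have gi': "g i' x = h i x + s * (real k + 1)" using i' i'P by (simp add: g algebra_simps)
  have gP: "j \<in> ?P" "g j x = h i x + s * (real m + 1)"
    if "j < n" "m \<le> k" "real j = real i + s * real m" for j m
  proof -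
    show P: "j \<in> ?P" using off that unfolding k_def by blast
    have "h j x = h i x + s * real m"
      using occ[of m] that unfolding k_def by (metis of_nat_eq_iff)
    then show "g j x = h i x + s * (real m + 1)" using P by (simp add: g algebra_simps)
  qed
  show "pushable (- s) g i' x"
    using pushed_paths_local_extremum[OF s h ix p i'P] i'P ix unfolding pushable_def g by auto
  show nb: "num_blocking n (- s) g i' x = num_blocking n s h i x"
    unfolding k_def[symmetric]
  proof (rule num_blocking_eqI)
    fix m assume m: "m < k"
    obtain j where j: "j < n" "real j = real i + s * real (k - Suc m)"
      using occ[of "k - Suc m"] unfolding k_def by auto
    have "g j x = h i x + s * (real (k - Suc m) + 1)" using gP(2)[OF j(1) _ j(2)] by simp
    also have "\<dots> = g i' x + - s * (real m + 1)"
      unfolding gi' using m by (simp add: of_nat_diff algebra_simps)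
    finally show "\<exists>j<n. g j x = g i' x + - s * (real m + 1)" using j(1) by blast
  next
    fix j assume "j < n"
    \<comment> \<open>The push vacates the old height of path \<open>i\<close>, which ends the tower
      of the opposite push after exactly \<open>k\<close> blocking paths.\<close>
    have "g j x \<noteq> h i x"
    proof (cases "j \<in> ?P")
      case True
      then obtain m where "m \<le> k" "real j = real i + s * real m"
        using off unfolding k_def by blast
      then have "g j x = h i x + s * (real m + 1)" using gP(2) \<open>j < n\<close> by blast
      then show ?thesis using s by auto
    next
      case False
      moreover have "i \<in> ?P" using gP(1)[OF ix(1), of 0] by simp
      ultimately have "j \<noteq> i" by blast
      then show ?thesis
        using False path_families_inj[OF h \<open>j < n\<close> ix(1) x] by (auto simp: g)
    qed
    then show "g j x \<noteq> g i' x + - s * (real k + 1)" unfolding gi' by simp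
  qed
  have s': "- s \<in> {1, - 1}" using s by auto
  have "pushed_paths n (- s) g i' x = ?P"
  proof (rule set_eqI)
    fix j
    have "j \<in> pushed_paths n (- s) g i' x \<longleftrightarrow>
      j < n \<and> (\<exists>m\<le>k. real j = real i + s * (real k - real m))"
      using pushed_paths_iff_offset[OF s' gPF \<open>i' < n\<close> x] i'(2)
      unfolding nb k_def[symmetric] by (auto simp: algebra_simps)
    also have "\<dots> \<longleftrightarrow> j < n \<and> (\<exists>m\<le>k. real j = real i + s * real m)"
      by (metis diff_diff_cancel diff_le_self of_nat_diff)
    also have "\<dots> \<longleftrightarrow> j \<in> ?P" using off unfolding k_def by blast
    finally show "j \<in> pushed_paths n (- s) g i' x \<longleftrightarrow> j \<in> ?P" .
  qed
  then show "push n (- s) g i' x = h"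
    unfolding push_def[of n "- s"] by (auto simp: g fun_eq_iff)
  show "reverse_index n (- s) g i' x = i"
    unfolding reverse_index_def nb k_def[symmetric] using i'(2) by simp
qed

section \<open>The monotone coupling of one step\<close>

text \<open>Acceptance with probability \<open>1 / (k + 1)\<close> is decided by a number \<open>u\<close> drawn uniformly
  below \<open>n!\<close>, which is a multiple of \<open>k + 1\<close>. Sharing \<open>u\<close> makes the coupling monotone.\<close>

definition move :: "nat \<Rightarrow> (nat \<times> nat) \<times> real \<times> nat \<Rightarrow> (nat \<Rightarrow> nat \<Rightarrow> real) \<Rightarrow> nat \<Rightarrow> nat \<Rightarrow> real" where
  "move n = (\<lambda>((i, x), s, u) h.
     if pushable s h i x \<and> u * (num_blocking n s h i x + 1) < fact n then push n s h i x else h)"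

definition seed :: "nat \<Rightarrow> ((nat \<times> nat) \<times> real \<times> nat) pmf" where
  "seed n = pair_pmf (pmf_of_set (internal_points n))
     (pair_pmf (pmf_of_set {1, - 1}) (pmf_of_set {..<fact n}))"

lemma internal_points_eq: "internal_points n = {..<n} \<times> {1..<2 * n}"
  by (auto simp: internal_points_def)

lemma internal_points_finite: "finite (internal_points n)"
  by (simp add: internal_points_eq)

lemma internal_points_nonempty: "0 < n \<Longrightarrow> internal_points n \<noteq> {}"
  by (auto simp: internal_points_eq)

lemma lessThan_fact_nonempty: "{..<fact n :: nat} \<noteq> {}"
  by (metis empty_iff fact_gt_zero lessThan_iff)

lemma set_pmf_seed:
  assumes "0 < n"
  shows "set_pmf (seed n) = internal_points n \<times> {1, - 1} \<times> {..<fact n}"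
  using internal_points_nonempty[OF assms] internal_points_finite lessThan_fact_nonempty
  by (simp add: seed_def)

lemma bernoulli_pmf_eq_map_uniform:
  assumes "0 < k" "k dvd N" "0 < N"
  shows "map_pmf (\<lambda>u. u * k < N) (pmf_of_set {..<N}) = bernoulli_pmf (1 / real k)"
    (is "?p = ?q")
proof -
  obtain c where c: "N = c * k" using assms(2) by (metis dvdE mult.commute)
  have "{..<N} \<inter> {u. u * k < N} = {..<c}"
    using assms c by (auto intro: less_le_trans[of _ c "c * k"])
  then have "pmf ?p True = pmf ?q True"
    using assms c by (auto simp: pmf_map vimage_def measure_pmf_of_set lessThan_empty_iff)
  moreover have "pmf ?p False = pmf ?q False"
    using calculation by (simp add: pmf_False_conv_True)
  ultimately show ?thesis by (intro pmf_eqI) (metis (full_types))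
qed

lemma LRS_step_eq_map_seed:
  assumes "0 < n" "h \<in> path_families n"
  shows "LRS_step n h = map_pmf (\<lambda>\<omega>. move n \<omega> h) (seed n)"
proof -
  have "(if pushable s h i x
       then map_pmf (\<lambda>accept. if accept then push n s h i x else h)
              (bernoulli_pmf (1 / (real (num_blocking n s h i x) + 1)))
       else return_pmf h) = map_pmf (\<lambda>u. move n ((i, x), s, u) h) (pmf_of_set {..<fact n})"
    if "(i, x) \<in> internal_points n" "s \<in> {1, - 1}" for i x s
  proof (cases "pushable s h i x")
    case True
    let ?k = "num_blocking n s h i x + 1"
    have "?k \<le> n"
      using num_blocking_less[OF that(2) assms(2), of i x] that(1) by (auto simp: internal_points_def)
    then have "?k dvd fact n" by (intro dvd_fact) auto
    then have "bernoulli_pmf (1 / (real (num_blocking n s h i x) + 1)) =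
      map_pmf (\<lambda>u. u * ?k < fact n) (pmf_of_set {..<fact n})"
      using bernoulli_pmf_eq_map_uniform[of ?k "fact n"] by (simp add: add.commute)
    then show ?thesis
      using True by (simp add: pmf.map_comp o_def move_def)
  next
    case False
    then show ?thesis by (simp add: move_def map_pmf_const)
  qed
  then have "LRS_step n h = bind_pmf (pmf_of_set (internal_points n)) (\<lambda>(i, x).
     bind_pmf (pmf_of_set {1, - 1}) (\<lambda>s.
       map_pmf (\<lambda>u. move n ((i, x), s, u) h) (pmf_of_set {..<fact n})))"
    unfolding LRS_step_def using internal_points_nonempty[OF assms(1)] internal_points_finite
    by (intro bind_pmf_cong refl) (auto split: prod.splits intro!: bind_pmf_cong)
  then show ?thesis
    by (simp add: seed_def pair_pmf_def map_bind_pmf bind_assoc_pmf bind_return_pmf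
        map_pmf_def case_prod_beta')
qed

lemma move_in_path_families:
  assumes "0 < n" "\<omega> \<in> set_pmf (seed n)" "h \<in> path_families n"
  shows "move n \<omega> h \<in> path_families n"
  using assms push_in_path_families[OF _ assms(3)]
  by (auto simp: set_pmf_seed move_def internal_points_def)

text \<open>In the order multiplied by \<open>s\<close> a push only raises heights, so order can
  fail only where the lower family moves a path that touches the upper one. There the upper family
  has the same base point, accepts whenever the lower one does, and its tower still reaches the
  touching path.\<close>

lemma move_mono_signed:
  assumes n: "0 < n" and \<omega>: "((i, x), s, u) \<in> set_pmf (seed n)"
    and h: "h \<in> path_families n" and g: "g \<in> path_families n"
    and le: "\<And>j y. s * h j y \<le> s * g j y"
  shows "s * move n ((i, x), s, u) h j y \<le> s * move n ((i, x), s, u) g j y"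
proof -
  let ?\<omega> = "((i, x), s, u)"
  have s: "s \<in> {1, - 1}" and ix: "i < n" "0 < x" "x < 2 * n" and x: "x \<le> 2 * n"
    using \<omega> n by (auto simp: set_pmf_seed internal_points_def)
  have ge: "s * f j y \<le> s * move n ?\<omega> f j y" for f j y
    using s by (auto simp: move_def push_def)
  consider "move n ?\<omega> h j y = h j y"
    | "pushable s h i x" "u * (num_blocking n s h i x + 1) < fact n"
      "j \<in> pushed_paths n s h i x" "y = x"
    by (cases "pushable s h i x \<and> u * (num_blocking n s h i x + 1) < fact n";
        cases "j \<in> pushed_paths n s h i x \<and> y = x") (auto simp: move_def push_def)
  then show ?thesis
  proof cases
    case 1
    then show ?thesis using le[of j y] ge[of g j y] by simp
  next
    case 2
    define k where "k = num_blocking n s h i x"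
    define k' where "k' = num_blocking n s g i x"
    have hj: "move n ?\<omega> h j y = h j x + s"
      using 2 by (simp add: move_def push_def)
    obtain m where j: "j < n" and m: "m \<le> k" "real j = real i + s * real m" "h j x = h i x + s * real m"
      using pushed_paths_iff[OF s h ix(1) x] 2(3) unfolding k_def by blast
    have mul: "s * (h i x + s * r) = s * h i x + r" for r using s by (auto simp: algebra_simps)
    show ?thesis
    proof (cases "h j x = g j x")
      case False
      then have "s * h j x + 1 \<le> s * g j x"
        using le[of j x] s path_families_diff_less[OF h g j j x] path_families_diff_less[OF g h j j x]
        by auto
      then show ?thesis using ge[of g j y] hj 2(4) s by (auto simp: algebra_simps)
    next
      case eq: True
      \<comment> \<open>Path \<open>i\<close> is squeezed: the gap to the touching path
        \<open>j\<close> bounds it from above in \<open>g\<close>, the order of the families from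
        below.\<close>
      have "s * g i x + real m \<le> s * g j x"
        using path_families_signed_gap[OF s g ix(1) j x m(2)] .
      then have gi: "g i x = h i x"
        using le[of i x] s m(3) eq mul[of "real m"] by auto
      have pg: "pushable s g i x"
        using 2(1) gi le[of i "x - 1"] le[of i "x + 1"] s path_families_step[OF g ix(1,3)]
          path_families_step'[OF g ix(1,2)] x unfolding pushable_def by auto
      have above: "s * h i x + real m' \<le> s * h j' x"
        if "j' < n" "real j' = real i + s * real m'" for j' m'
        using path_families_signed_gap[OF s h ix(1) that(1) x that(2)] .
      \<comment> \<open>A longer tower in \<open>g\<close> would trap path \<open>k + 1\<close> of
        the sequence in \<open>h\<close> between the gap condition and \<open>g\<close>, exactly at
        the height that is free in \<open>h\<close>.\<close>
      have "k' \<le> k"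
      proof (rule ccontr)
        assume "\<not> k' \<le> k"
        then obtain j' where j': "j' < n" "real j' = real i + s * real (k + 1)"
          "g j' x = g i x + s * real (k + 1)"
          using num_blocking_occupied[OF s g ix(1) x, of "k + 1"] unfolding k'_def by auto
        then have "s * h j' x = s * h i x + real (k + 1)"
          using above[OF j'(1,2)] le[of j' x] mul gi by simp
        then have "h j' x = h i x + s * (real k + 1)"
          using s by auto
        then show False using num_blocking_free[OF s j'(1)] unfolding k_def by blast
      qed
      have acc: "u * (k' + 1) < fact n"
        using 2(2) \<open>k' \<le> k\<close> unfolding k_def by (meson add_le_mono1 le_less_trans mult_le_mono2)
      \<comment> \<open>If the tower of \<open>g\<close> ended before path \<open>j\<close>, the
        next path would lie strictly higher in \<open>g\<close> than in \<open>h\<close>, and the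
        gaps would pass this on to \<open>j\<close>, where the families touch.\<close>
      have "m \<le> k'"
      proof (rule ccontr)
        assume "\<not> m \<le> k'"
        then obtain l where l: "m = k' + 1 + l" by (metis Suc_eq_plus1 less_eqE not_less_eq_eq)
        obtain j' where j': "j' < n" "real j' = real i + s * real (k' + 1)"
          "h j' x = h i x + s * real (k' + 1)"
          using num_blocking_occupied[OF s h ix(1) x, of "k' + 1"] l m(1) unfolding k_def by auto
        have "g j' x \<noteq> h j' x"
          using num_blocking_free[OF s j'(1), of g x i] j'(3) gi unfolding k'_def
          by (simp add: add.commute[of 1])
        then have "s * h j' x < s * g j' x" using le[of j' x] s by auto
        moreover have "real j = real j' + s * real l"
          using l m(2) j'(2) by (simp add: algebra_simps)
        then have "s * g j' x + real l \<le> s * g j x"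
          using path_families_signed_gap[OF s g j'(1) j x] by blast
        ultimately show False
          using eq m(3) j'(3) l mul[of "real m"] mul[of "real (k' + 1)"] by simp
      qed
      then have "j \<in> pushed_paths n s g i x"
        using pushed_paths_iff_offset[OF s g ix(1) x] j m(2) unfolding k'_def by blast
      then have "move n ?\<omega> g j y = g j x + s"
        using pg acc 2(4) unfolding k'_def by (simp add: move_def push_def)
      then show ?thesis using hj eq by simp
    qed
  qed
qed

lemma move_mono:
  assumes "0 < n" "\<omega> \<in> set_pmf (seed n)" "h \<in> path_families n" "g \<in> path_families n" "h \<le> g"
  shows "move n \<omega> h \<le> move n \<omega> g"
proof -
  obtain i x s u where \<omega>: "\<omega> = ((i, x), s, u)" by (metis surj_pair)
  have "s = 1 \<or> s = - 1" using assms(1,2) by (auto simp: \<omega> set_pmf_seed)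
  then show ?thesis
  proof
    assume s: "s = 1"
    then show ?thesis
      using move_mono_signed[of n i x s u h g] assms by (auto simp: \<omega> le_fun_def)
  next
    assume s: "s = - 1"
    then show ?thesis
      using move_mono_signed[of n i x s u g h] assms by (auto simp: \<omega> le_fun_def)
  qed
qed


section \<open>Generator and stationarity\<close>

lemma expectation_bind_pmf_finite:
  fixes h :: "'b \<Rightarrow> real"
  assumes "finite (set_pmf p)" "\<And>x. x \<in> set_pmf p \<Longrightarrow> finite (set_pmf (f x))"
  shows "measure_pmf.expectation (bind_pmf p f) h =
    measure_pmf.expectation p (\<lambda>x. measure_pmf.expectation (f x) h)"
  by (subst pmf_expectation_bind[OF assms order_refl], assumption,
      subst integral_measure_pmf[OF assms(1)]) auto

lemma expectation_mono_pmf_finite: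
  fixes f g :: "'a \<Rightarrow> real"
  assumes "finite (set_pmf p)" "\<And>x. x \<in> set_pmf p \<Longrightarrow> f x \<le> g x"
  shows "measure_pmf.expectation p f \<le> measure_pmf.expectation p g"
  using assms by (intro integral_mono_AE integrable_measure_pmf_finite) (auto simp: AE_measure_pmf_iff)

text \<open>The increment of \<open>f\<close> averaged over acceptance only, for a fixed point and
  direction.\<close>

definition jump :: "nat \<Rightarrow> ((nat \<Rightarrow> nat \<Rightarrow> real) \<Rightarrow> real) \<Rightarrow> (nat \<Rightarrow> nat \<Rightarrow> real) \<Rightarrow> real \<Rightarrow> nat \<times> nat \<Rightarrow> real"
  where "jump n f h s = (\<lambda>(i, x). if pushable s h i x
    then (f (push n s h i x) - f h) / (real (num_blocking n s h i x) + 1) else 0)"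

lemma expectation_LRS_step:
  assumes "0 < n"
  shows "measure_pmf.expectation (LRS_step n h) f =
    f h + (\<Sum>p\<in>internal_points n. \<Sum>s\<in>{1, - 1}. jump n f h s p) / (2 * real (card (internal_points n)))"
proof -
  let ?I = "internal_points n" and ?S = "{1, - 1} :: real set"
  define B where "B = (\<lambda>(i, x) s. if pushable s h i x
       then map_pmf (\<lambda>accept. if accept then push n s h i x else h)
              (bernoulli_pmf (1 / (real (num_blocking n s h i x) + 1)))
       else return_pmf h)"
  have fin: "finite (set_pmf (B p s))" for p s
    by (auto simp: B_def split: prod.split)
  have B: "measure_pmf.expectation (B p s) f = f h + jump n f h s p" for p s
    by (auto simp: B_def jump_def diff_divide_distrib algebra_simps split: prod.split)
  have "LRS_step n h = bind_pmf (pmf_of_set ?I) (\<lambda>p. bind_pmf (pmf_of_set ?S) (B p))"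
    unfolding LRS_step_def B_def by (simp add: case_prod_beta')
  then have "measure_pmf.expectation (LRS_step n h) f =
      measure_pmf.expectation (pmf_of_set ?I) (\<lambda>p. measure_pmf.expectation (pmf_of_set ?S)
        (\<lambda>s. f h + jump n f h s p))"
    using fin internal_points_nonempty[OF assms] internal_points_finite
    by (simp add: expectation_bind_pmf_finite B set_pmf_of_set)
  also have "\<dots> = (\<Sum>p\<in>?I. f h + (\<Sum>s\<in>?S. jump n f h s p) / 2) / card ?I"
    using internal_points_nonempty[OF assms] internal_points_finite
    by (simp add: integral_pmf_of_set add_divide_distrib)
  also have "\<dots> = f h + (\<Sum>p\<in>?I. \<Sum>s\<in>?S. jump n f h s p) / (2 * card ?I)"
    using internal_points_nonempty[OF assms] internal_points_finite
    by (simp add: sum.distrib sum_divide_distrib[symmetric] field_simps)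
  finally show ?thesis by simp
qed

text \<open>Reversibility in summed form: \<open>F\<close> is an involution on the possible pushes
  that exchanges the states before and after and keeps the tower size, hence the acceptance
  probability, so the increments cancel in pairs.\<close>

lemma sum_jump_eq_0:
  "(\<Sum>h\<in>path_families n. \<Sum>p\<in>internal_points n. \<Sum>s\<in>{1, - 1}. jump n f h s p) = 0"
proof -
  let ?A = "path_families n \<times> internal_points n \<times> {1, - 1 :: real}"
  define X where "X = {a \<in> ?A. case a of (h, (i, x), s) \<Rightarrow> pushable s h i x}"
  define F where "F = (\<lambda>(h, (i, x), s).
    (push n s h i x, (reverse_index n s h i x, x), - s :: real))"
  have finA: "finite ?A"
    using path_families_finite internal_points_finite by simp
  have F: "F a \<in> X" "F (F a) = a" "(case F a of (h, (i, x), s) \<Rightarrow> num_blocking n s h i x) =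
     (case a of (h, (i, x), s) \<Rightarrow> num_blocking n s h i x)" if "a \<in> X" for a
  proof -
    obtain h i x s where a: "a = (h, (i, x), s)" by (metis surj_pair)
    have *: "s \<in> {1, - 1}" "h \<in> path_families n" "i < n" "0 < x" "x < 2 * n" "pushable s h i x"
      using that unfolding X_def a internal_points_def by auto
    have "- s \<in> {1, - 1}" using *(1) by auto
    then show "F a \<in> X" "F (F a) = a" "(case F a of (h, (i, x), s) \<Rightarrow> num_blocking n s h i x) =
       (case a of (h, (i, x), s) \<Rightarrow> num_blocking n s h i x)"
      using push_reverse[OF *] push_in_path_families[OF *] *
      by (simp_all add: a F_def X_def internal_points_def)
  qed
  let ?k = "\<lambda>a. case a of (h, (i, x), s) \<Rightarrow> real (num_blocking n s h i x) + 1"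
  have kF: "?k (F a) = ?k a" if "a \<in> X" for a
    using F(3)[OF that] by (auto split: prod.splits)
  have "(\<Sum>h\<in>path_families n. \<Sum>p\<in>internal_points n. \<Sum>s\<in>{1, - 1}. jump n f h s p) =
    (\<Sum>(h, p, s)\<in>?A. jump n f h s p)"
    by (simp only: sum.cartesian_product split_def fst_conv snd_conv)
  also have "\<dots> = (\<Sum>a\<in>X. f (fst (F a)) / ?k a - f (fst a) / ?k a)"
    unfolding X_def sum.inter_filter[OF finA]
    by (intro sum.cong refl) (auto simp: jump_def F_def diff_divide_distrib)
  also have "\<dots> = (\<Sum>a\<in>X. f (fst (F a)) / ?k a) - (\<Sum>a\<in>X. f (fst a) / ?k a)"
    by (rule sum_subtractf)
  also have "(\<Sum>a\<in>X. f (fst (F a)) / ?k a) = (\<Sum>a\<in>X. f (fst a) / ?k a)"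
    by (rule sum.reindex_bij_witness[of _ F F]) (use F kF in auto)
  finally show ?thesis by simp
qed

text \<open>For \<open>f\<close> the indicator of a state, the vanishing total increment says that
  the uniform mass of that state is preserved.\<close>

lemma uniform_stationary:
  assumes "0 < n"
  shows "bind_pmf (pmf_of_set (path_families n)) (LRS_step n) = pmf_of_set (path_families n)"
proof (rule pmf_eqI)
  fix y :: "nat \<Rightarrow> nat \<Rightarrow> real"
  let ?U = "path_families n" and ?f = "indicator {y} :: (nat \<Rightarrow> nat \<Rightarrow> real) \<Rightarrow> real"
  have ind: "pmf p y = measure_pmf.expectation p ?f" for p
    by (simp add: measure_pmf_single)
  have "pmf (bind_pmf (pmf_of_set ?U) (LRS_step n)) y =
    measure_pmf.expectation (pmf_of_set ?U) (\<lambda>h. measure_pmf.expectation (LRS_step n h) ?f)"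
    unfolding pmf_bind by (simp only: ind)
  also have "\<dots> = (\<Sum>h\<in>?U. ?f h) / card ?U"
    unfolding expectation_LRS_step[OF assms]
      integral_pmf_of_set[OF path_families_nonempty path_families_finite]
      sum.distrib sum_divide_distrib[symmetric] sum_jump_eq_0 by simp
  also have "\<dots> = pmf (pmf_of_set ?U) y"
    unfolding ind integral_pmf_of_set[OF path_families_nonempty path_families_finite] ..
  finally show "pmf (bind_pmf (pmf_of_set ?U) (LRS_step n)) y = pmf (pmf_of_set ?U) y" .
qed

section \<open>Contraction of the weighted area\<close>

text \<open>The end columns are left out because all families agree there.\<close>

definition weighted_area :: "nat \<Rightarrow> (nat \<Rightarrow> real) \<Rightarrow> (nat \<Rightarrow> nat \<Rightarrow> real) \<Rightarrow> real" where
  "weighted_area n w h = (\<Sum>x\<in>{1..<2 * n}. w x * (\<Sum>i<n. h i x))"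

lemma weighted_area_push:
  assumes s: "s \<in> {1, - 1}" and h: "h \<in> path_families n" and ix: "i < n" "0 < x" "x < 2 * n"
  shows "weighted_area n w (push n s h i x) =
    weighted_area n w h + w x * s * (real (num_blocking n s h i x) + 1)"
proof -
  let ?P = "pushed_paths n s h i x"
  have P: "?P \<subseteq> {..<n}" by (auto simp: pushed_paths_def)
  have "(\<Sum>j<n. push n s h i x j y) = (\<Sum>j<n. h j y) + (if y = x then s * card ?P else 0)" for y
  proof -
    have "(\<Sum>j<n. push n s h i x j y) = (\<Sum>j<n. h j y + (if j \<in> ?P then if y = x then s else 0 else 0))"
      by (intro sum.cong) (auto simp: push_def)
    also have "\<dots> = (\<Sum>j<n. h j y) + (\<Sum>j\<in>?P. if y = x then s else 0)"
      using P by (simp add: sum.distrib sum.inter_restrict[symmetric] inf_absorb2)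
    finally show ?thesis by simp
  qed
  then have "weighted_area n w (push n s h i x) =
    (\<Sum>y\<in>{1..<2 * n}. w y * (\<Sum>i<n. h i y) + (if y = x then w x * (s * card ?P) else 0))"
    unfolding weighted_area_def by (intro sum.cong) (auto simp: algebra_simps)
  also have "\<dots> = weighted_area n w h + w x * (s * card ?P)"
    using ix by (simp add: sum.distrib weighted_area_def)
  finally show ?thesis
    using card_pushed_paths[OF s h, of i x] ix by simp
qed

text \<open>A push moves \<open>k + 1\<close> paths with probability \<open>1 / (k + 1)\<close>, so
  its mean effect is \<open>s * w x\<close> for any amount of blocking. The second difference of
  path \<open>i\<close> at \<open>x\<close> is \<open>s\<close> at a local extremum pushable in
  direction \<open>s\<close> and 0 elsewhere, so it records this drift exactly.\<close>

lemma expectation_weighted_area: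
  assumes n: "0 < n" and h: "h \<in> path_families n"
  shows "measure_pmf.expectation (LRS_step n h) (weighted_area n w) = weighted_area n w h +
    (\<Sum>i<n. \<Sum>x\<in>{1..<2 * n}. w x * (h i (x - 1) + h i (x + 1) - 2 * h i x)) /
      (2 * (real n * (2 * real n - 1)))"
proof -
  have "(\<Sum>s\<in>{1, - 1}. jump n (weighted_area n w) h s (i, x)) =
      w x * (h i (x - 1) + h i (x + 1) - 2 * h i x)" if "i < n" "x \<in> {1..<2 * n}" for i x
  proof -
    have j: "jump n (weighted_area n w) h s (i, x) = (if pushable s h i x then w x * s else 0)"
      if "s \<in> {1, - 1}" for s
      using weighted_area_push[OF that h, of i x w] \<open>i < n\<close> \<open>x \<in> _\<close> by (simp add: jump_def)
    show ?thesis
      using j[of 1] j[of "- 1"] path_families_step[OF h \<open>i < n\<close>, of x]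
        path_families_step'[OF h \<open>i < n\<close>, of x] that
      by (auto simp: pushable_def)
  qed
  then have "(\<Sum>p\<in>internal_points n. \<Sum>s\<in>{1, - 1}. jump n (weighted_area n w) h s p) =
    (\<Sum>i<n. \<Sum>x\<in>{1..<2 * n}. w x * (h i (x - 1) + h i (x + 1) - 2 * h i x))"
    unfolding internal_points_eq sum.cartesian_product[of _ "{1..<2 * n}"]
    by (intro sum.cong refl) auto
  moreover have "real (card (internal_points n)) = real n * (2 * real n - 1)"
    using n by (simp add: internal_points_eq of_nat_diff)
  ultimately show ?thesis
    unfolding expectation_LRS_step[OF n] by simp
qed

text \<open>Discrete Green identity: the right-hand side is the difference of the Casoratians of
  \<open>w\<close> and \<open>a\<close> at the two ends.\<close>

lemma summation_by_parts_discrete_laplacian: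
  fixes w a :: "nat \<Rightarrow> real"
  assumes "0 < M"
  shows "(\<Sum>x\<in>{1..<M}. w x * (a (x - 1) + a (x + 1))) - (\<Sum>x\<in>{1..<M}. (w (x - 1) + w (x + 1)) * a x) =
    w (M - 1) * a M - w M * a (M - 1) - (w 0 * a 1 - w 1 * a 0)"
  using assms
proof (induction M)
  case (Suc M)
  show ?case
  proof (cases "M = 0")
    case False
    then show ?thesis using Suc by (simp add: algebra_simps)
  qed simp
qed simp

definition cos_weight :: "real \<Rightarrow> nat \<Rightarrow> nat \<Rightarrow> real" where
  "cos_weight \<theta> n x = cos (\<theta> * (real x - real n) / real n)"

lemma cos_weight_eigen:
  assumes "1 \<le> x"
  shows "cos_weight \<theta> n (x - 1) + cos_weight \<theta> n (x + 1) = 2 * cos (\<theta> / n) * cos_weight \<theta> n x"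
proof -
  define a where "a = \<theta> * (real x - real n) / real n"
  have "\<theta> * (real (x - 1) - real n) / real n = a - \<theta> / n"
    "\<theta> * (real (x + 1) - real n) / real n = a + \<theta> / n"
    using assms by (simp_all add: a_def of_nat_diff diff_divide_distrib add_divide_distrib algebra_simps)
  then show ?thesis
    by (simp add: cos_weight_def a_def[symmetric] cos_add cos_diff)
qed

lemma cos_weight_ge:
  assumes "0 < \<theta>" "\<theta> < pi / 2" "x \<le> 2 * n"
  shows "cos \<theta> \<le> cos_weight \<theta> n x"
proof -
  let ?r = "(real x - real n) / real n"
  \<comment> \<open>For \<open>n = 0\<close> division by zero gives \<open>?r = 0\<close>.\<close>
  have "\<bar>?r\<bar> \<le> 1" using assms(3) by (cases "n = 0") (auto simp: abs_le_iff field_simps)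
  then have "\<bar>\<theta> * ?r\<bar> \<le> \<theta>"
    using mult_left_mono[of "\<bar>?r\<bar>" 1 \<theta>] assms(1) by (simp add: abs_mult)
  then have "cos \<theta> \<le> cos \<bar>\<theta> * ?r\<bar>"
    using assms pi_gt_zero by (intro cos_monotone_0_pi_le) auto
  then show ?thesis by (simp add: cos_weight_def cos_abs_real del: abs_mult abs_divide)
qed

text \<open>The denominator is the number of internal points. The direction probability 1/2 has
  cancelled the factor 2 of the eigenvalue \<open>2 * (1 - cos (\<theta> / n))\<close>.\<close>

definition contraction_factor :: "real \<Rightarrow> nat \<Rightarrow> real" where
  "contraction_factor \<theta> n = 1 - (1 - cos (\<theta> / n)) / (real n * (2 * real n - 1))"

text \<open>The weight satisfies the eigenvalue equation of the discrete Laplacian but not its Dirichlet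
  condition. It is positive at both ends, so the boundary terms of the summation by parts only help,
  and it is bounded below by the constant \<open>cos \<theta>\<close>; the true eigenvector (\<open>\<theta> = pi / 2\<close>) would
  be as small as \<open>1 / n\<close> and lead to the constant 64 in place of 48.\<close>

lemma weighted_area_contraction:
  assumes n: "0 < n" and \<theta>: "0 < \<theta>" "\<theta> < pi / 2"
    and h: "h \<in> path_families n" and g: "g \<in> path_families n" and le: "h \<le> g"
  shows "measure_pmf.expectation (LRS_step n g) (weighted_area n (cos_weight \<theta> n)) -
      measure_pmf.expectation (LRS_step n h) (weighted_area n (cos_weight \<theta> n)) \<le>
    contraction_factor \<theta> n *
      (weighted_area n (cos_weight \<theta> n) g - weighted_area n (cos_weight \<theta> n) h)"
proof -
  let ?w = "cos_weight \<theta> n" and ?I = "{1..<2 * n}" and ?N = "real n * (2 * real n - 1)"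
  define c where "c = cos (\<theta> / n)"
  define D where "D = weighted_area n ?w g - weighted_area n ?w h"
  define a where "a i x = g i x - h i x" for i x
  define L where "L f = (\<Sum>i<n. \<Sum>x\<in>?I. ?w x * (f i (x - 1) + f i (x + 1) - 2 * f i x))"
    for f :: "nat \<Rightarrow> nat \<Rightarrow> real"
  have w: "0 \<le> ?w x" if "x \<le> 2 * n" for x
    using cos_weight_ge[OF \<theta> that] cos_gt_zero[of \<theta>] \<theta> by linarith
  have a: "0 \<le> a i x" for i x using le by (auto simp: a_def le_fun_def)
  have bd: "a i 0 = 0" "a i (2 * n) = 0" if "i < n" for i
    using h g that by (auto simp: a_def path_families_def)
  have D: "D = (\<Sum>i<n. \<Sum>x\<in>?I. ?w x * a i x)"
    unfolding D_def weighted_area_def a_def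
    by (subst sum.swap) (simp add: sum_subtractf sum_distrib_left right_diff_distrib)
  have "(\<Sum>x\<in>?I. ?w x * (a i (x - 1) + a i (x + 1) - 2 * a i x)) \<le>
      - 2 * (1 - c) * (\<Sum>x\<in>?I. ?w x * a i x)" if "i < n" for i
  proof -
    have "(\<Sum>x\<in>?I. ?w x * (a i (x - 1) + a i (x + 1))) - (\<Sum>x\<in>?I. (?w (x - 1) + ?w (x + 1)) * a i x)
      = - ?w (2 * n) * a i (2 * n - 1) - ?w 0 * a i 1"
      using summation_by_parts_discrete_laplacian[of "2 * n" ?w "a i"] n bd[OF that] by simp
    also have "\<dots> \<le> 0"
      using mult_nonneg_nonneg[OF w[of "2 * n"] a, of i "2 * n - 1"]
        mult_nonneg_nonneg[OF w[of 0] a, of i 1] by simp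
    finally have "(\<Sum>x\<in>?I. ?w x * (a i (x - 1) + a i (x + 1))) \<le>
      (\<Sum>x\<in>?I. (?w (x - 1) + ?w (x + 1)) * a i x)" by simp
    also have "\<dots> = (\<Sum>x\<in>?I. 2 * c * (?w x * a i x))"
      by (intro sum.cong refl) (use cos_weight_eigen in \<open>auto simp: c_def\<close>)
    finally show ?thesis
      by (simp add: right_diff_distrib sum_subtractf sum_distrib_left[symmetric] algebra_simps)
  qed
  then have "L a \<le> - 2 * (1 - c) * D"
    unfolding D L_def sum_distrib_left[of "- 2 * (1 - c)"] by (rule sum_mono) (simp only: lessThan_iff)
  moreover have "L a = L g - L h"
    unfolding L_def sum_subtractf[symmetric] by (intro sum.cong refl) (simp add: a_def algebra_simps)
  moreover have "0 < 2 * ?N" using n by simp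
  ultimately have "(L g - L h) / (2 * ?N) \<le> - 2 * (1 - c) * D / (2 * ?N)"
    by (intro divide_right_mono) auto
  also have "\<dots> = - ((1 - c) / ?N * D)"
  proof -
    have "- 2 * (1 - c) * D / (2 * M) = - ((1 - c) / M * D)" if "0 < M" for M
      using that by (simp add: field_simps)
    then show ?thesis using \<open>0 < 2 * ?N\<close> by simp
  qed
  finally have "L g / (2 * ?N) - L h / (2 * ?N) \<le> - ((1 - c) / ?N * D)"
    unfolding diff_divide_distrib .
  then show ?thesis
    unfolding expectation_weighted_area[OF n h] expectation_weighted_area[OF n g] L_def[symmetric]
      contraction_factor_def c_def[symmetric] D_def[symmetric] left_diff_distrib[of 1]
    by (simp add: D_def)
qed

section \<open>The grand coupling and the mixing time\<close>

text \<open>A random self-map instead of a pair of copies: every starting state, also a random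
  stationary one, is driven by the same seeds.\<close>

primrec flow :: "nat \<Rightarrow> nat \<Rightarrow> ((nat \<Rightarrow> nat \<Rightarrow> real) \<Rightarrow> nat \<Rightarrow> nat \<Rightarrow> real) pmf" where
  "flow n 0 = return_pmf (\<lambda>h. h)"
| "flow n (Suc t) = bind_pmf (flow n t) (\<lambda>F. map_pmf (\<lambda>\<omega> h. move n \<omega> (F h)) (seed n))"

lemma finite_set_pmf_seed: "0 < n \<Longrightarrow> finite (set_pmf (seed n))"
  by (simp add: set_pmf_seed internal_points_finite)

lemma finite_set_pmf_flow: "0 < n \<Longrightarrow> finite (set_pmf (flow n t))"
  by (induction t) (auto simp: finite_set_pmf_seed)

lemma flow_in_path_families:
  assumes "0 < n" "F \<in> set_pmf (flow n t)" "h \<in> path_families n"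
  shows "F h \<in> path_families n"
  using assms(2) by (induction t arbitrary: F) (use assms move_in_path_families in auto)

lemma flow_mono:
  assumes "0 < n" "F \<in> set_pmf (flow n t)" "h \<in> path_families n" "g \<in> path_families n" "h \<le> g"
  shows "F h \<le> F g"
  using assms(2)
proof (induction t arbitrary: F)
  case (Suc t)
  then obtain G \<omega> where "G \<in> set_pmf (flow n t)" "\<omega> \<in> set_pmf (seed n)" "F = (\<lambda>h. move n \<omega> (G h))"
    by auto
  then show ?case
    using Suc.IH assms flow_in_path_families move_mono by metis
qed (use assms in auto)

lemma LRS_law_Suc: "LRS_law n h (Suc t) = bind_pmf (LRS_law n h t) (LRS_step n)"
  by (simp add: LRS_law_def)

lemma LRS_law_eq_map_flow:
  assumes "0 < n" "h \<in> path_families n"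
  shows "LRS_law n h t = map_pmf (\<lambda>F. F h) (flow n t)"
proof (induction t)
  case 0
  then show ?case by (simp add: LRS_law_def)
next
  case (Suc t)
  have "LRS_law n h (Suc t) = bind_pmf (flow n t) (\<lambda>F. LRS_step n (F h))"
    unfolding LRS_law_Suc Suc bind_map_pmf ..
  also have "\<dots> = bind_pmf (flow n t) (\<lambda>F. map_pmf (\<lambda>\<omega>. move n \<omega> (F h)) (seed n))"
    using assms flow_in_path_families LRS_step_eq_map_seed by (intro bind_pmf_cong refl) blast
  finally show ?case
    by (simp add: map_bind_pmf pmf.map_comp o_def)
qed

text \<open>Every realisation of the flow preserves the order, so the one-step bound applies
  conditionally on it. The nonnegative factor lets the induction hypothesis be multiplied.\<close>

lemma flow_contraction:
  assumes n: "0 < n" and \<theta>: "0 < \<theta>" "\<theta> < pi / 2" "0 \<le> contraction_factor \<theta> n"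
    and h: "h \<in> path_families n" and g: "g \<in> path_families n" and le: "h \<le> g"
  defines "A \<equiv> weighted_area n (cos_weight \<theta> n)"
  shows "measure_pmf.expectation (flow n t) (\<lambda>F. A (F g) - A (F h)) \<le>
    contraction_factor \<theta> n ^ t * (A g - A h)"
proof (induction t)
  case (Suc t)
  let ?E = "measure_pmf.expectation" and ?c = "contraction_factor \<theta> n"
  have seed: "?E (seed n) (\<lambda>\<omega>. A (move n \<omega> f)) = ?E (LRS_step n f) A"
    if "f \<in> path_families n" for f
    using LRS_step_eq_map_seed[OF n that] by simp
  have "?E (flow n (Suc t)) (\<lambda>F. A (F g) - A (F h)) =
    ?E (flow n t) (\<lambda>F. ?E (seed n) (\<lambda>\<omega>. A (move n \<omega> (F g)) - A (move n \<omega> (F h))))"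
    using finite_set_pmf_flow[OF n] finite_set_pmf_seed[OF n]
    by (simp add: expectation_bind_pmf_finite)
  also have "\<dots> \<le> ?E (flow n t) (\<lambda>F. ?c * (A (F g) - A (F h)))"
  proof (rule expectation_mono_pmf_finite[OF finite_set_pmf_flow[OF n]])
    fix F assume F: "F \<in> set_pmf (flow n t)"
    note PF = flow_in_path_families[OF n F h] flow_in_path_families[OF n F g]
    have "?E (seed n) (\<lambda>\<omega>. A (move n \<omega> (F g)) - A (move n \<omega> (F h))) =
      ?E (LRS_step n (F g)) A - ?E (LRS_step n (F h)) A"
      using finite_set_pmf_seed[OF n]
      by (subst Bochner_Integration.integral_diff)
        (auto intro: integrable_measure_pmf_finite simp: seed PF)
    also have "\<dots> \<le> ?c * (A (F g) - A (F h))"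
      unfolding A_def by (rule weighted_area_contraction[OF n \<theta>(1,2) PF flow_mono[OF n F h g le]])
    finally show "?E (seed n) (\<lambda>\<omega>. A (move n \<omega> (F g)) - A (move n \<omega> (F h))) \<le> ?c * (A (F g) - A (F h))" .
  qed
  also have "\<dots> = ?c * ?E (flow n t) (\<lambda>F. A (F g) - A (F h))" by simp
  also have "\<dots> \<le> ?c * (?c ^ t * (A g - A h))" using Suc \<theta>(3) by (rule mult_left_mono)
  finally show ?case by (simp add: mult.assoc)
qed simp

section \<open>Coupling inequality and coalescence\<close>

lemma tv_dist_map_pmf_le:
  assumes "finite (set_pmf r)"
  shows "tv_dist (map_pmf f r) (map_pmf g r) \<le> measure_pmf.prob r {x. f x \<noteq> g x}"
proof -
  let ?R = "set_pmf r" and ?E = "measure_pmf.expectation r"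
  let ?A = "f ` ?R \<union> g ` ?R"
  have pmf: "pmf (map_pmf u r) y = ?E (\<lambda>x. of_bool (u x = y))" for u :: "'a \<Rightarrow> 'b" and y
  proof -
    have "pmf (map_pmf u r) y = ?E (indicator (u -` {y}))" by (simp add: pmf_map)
    also have "\<dots> = ?E (\<lambda>x. of_bool (u x = y))"
      by (intro arg_cong[of _ _ ?E]) (auto simp: indicator_def)
    finally show ?thesis .
  qed
  have int: "integrable r u" for u :: "'a \<Rightarrow> real"
    using assms by (rule integrable_measure_pmf_finite)
  have finA: "finite ?A" using assms by simp
  have "(\<Sum>\<^sub>\<infinity>y. \<bar>pmf (map_pmf f r) y - pmf (map_pmf g r) y\<bar>) =
    (\<Sum>\<^sub>\<infinity>y\<in>?A. \<bar>pmf (map_pmf f r) y - pmf (map_pmf g r) y\<bar>)"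
    by (intro infsum_cong_neutral) (auto simp: pmf_map_outside)
  also have "\<dots> = (\<Sum>y\<in>?A. \<bar>?E (\<lambda>x. of_bool (f x = y)) - ?E (\<lambda>x. of_bool (g x = y))\<bar>)"
    by (simp only: infsum_finite[OF finA] pmf)
  also have "\<dots> \<le> (\<Sum>y\<in>?A. ?E (\<lambda>x. \<bar>of_bool (f x = y) - of_bool (g x = y)\<bar>))"
    by (intro sum_mono) (simp add: Bochner_Integration.integral_diff[OF int int, symmetric] integral_abs_bound)
  also have "\<dots> = ?E (\<lambda>x. \<Sum>y\<in>?A. \<bar>of_bool (f x = y) - of_bool (g x = y)\<bar>)"
    by (rule Bochner_Integration.integral_sum[symmetric]) (rule int)
  \<comment> \<open>A disagreement is counted at two values of \<open>y\<close>, an agreement at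
    none; the 2 cancels the 1/2 in \<open>tv_dist\<close>.\<close>
  also have "\<dots> \<le> ?E (\<lambda>x. 2 * indicator {x. f x \<noteq> g x} x)"
  proof (rule expectation_mono_pmf_finite[OF assms])
    fix x
    show "(\<Sum>y\<in>?A. \<bar>of_bool (f x = y) - of_bool (g x = y) :: real\<bar>) \<le> 2 * indicator {x. f x \<noteq> g x} x"
    proof (cases "f x = g x")
      case False
      have "(\<Sum>y\<in>?A. \<bar>of_bool (f x = y) - of_bool (g x = y) :: real\<bar>) \<le>
        (\<Sum>y\<in>?A. of_bool (f x = y) + of_bool (g x = y))"
        by (intro sum_mono) auto
      also have "\<dots> \<le> 2" using finA by (auto simp: sum.distrib of_bool_def sum.delta')
      finally show ?thesis using False by simp
    qed simp
  qed
  finally show ?thesis by (simp add: tv_dist_def)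
qed

lemma bind_uniform_LRS_law:
  assumes "0 < n"
  shows "bind_pmf (pmf_of_set (path_families n)) (\<lambda>h. LRS_law n h t) = pmf_of_set (path_families n)"
proof (induction t)
  case 0
  then show ?case by (simp add: LRS_law_def bind_return_pmf')
next
  case (Suc t)
  then show ?case
    using uniform_stationary[OF assms] by (simp add: LRS_law_Suc bind_assoc_pmf[symmetric])
qed

text \<open>The copy from \<open>h\<close> is compared with a copy whose uniform start is
  independent of the flow and which stays uniform by stationarity. Both are sandwiched between the
  images of \<open>lo\<close> and \<open>hi\<close>, so they agree once these coincide.\<close>

lemma tv_dist_LRS_law_le:
  assumes n: "0 < n" and h: "h \<in> path_families n"
    and lo: "lo \<in> path_families n" "\<And>g. g \<in> path_families n \<Longrightarrow> lo \<le> g"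
    and hi: "hi \<in> path_families n" "\<And>g. g \<in> path_families n \<Longrightarrow> g \<le> hi"
  shows "tv_dist (LRS_law n h t) (pmf_of_set (path_families n)) \<le>
    measure_pmf.prob (flow n t) {F. F hi \<noteq> F lo}"
proof -
  let ?U = "pmf_of_set (path_families n)"
  let ?r = "pair_pmf (flow n t) ?U"
  have supp: "set_pmf ?U = path_families n"
    by (simp add: path_families_nonempty path_families_finite)
  have "map_pmf (\<lambda>(F, g). F h) ?r = map_pmf (\<lambda>F. F h) (map_pmf fst ?r)"
    by (simp only: pmf.map_comp o_def case_prod_beta')
  then have 1: "map_pmf (\<lambda>(F, g). F h) ?r = LRS_law n h t"
    using LRS_law_eq_map_flow[OF n h] by (simp add: map_fst_pair_pmf)
  have "map_pmf (\<lambda>(F, g). F g) ?r = bind_pmf (flow n t) (\<lambda>F. bind_pmf ?U (\<lambda>g. return_pmf (F g)))"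
    by (simp add: pair_pmf_def map_bind_pmf)
  also have "\<dots> = bind_pmf ?U (\<lambda>g. map_pmf (\<lambda>F. F g) (flow n t))"
    unfolding map_pmf_def by (rule bind_commute_pmf)
  also have "\<dots> = bind_pmf ?U (\<lambda>g. LRS_law n g t)"
    using LRS_law_eq_map_flow[OF n] supp by (intro bind_pmf_cong) auto
  finally have 2: "map_pmf (\<lambda>(F, g). F g) ?r = ?U"
    using bind_uniform_LRS_law[OF n] by simp
  have "finite (set_pmf ?r)"
    using finite_set_pmf_flow[OF n] supp path_families_finite by simp
  from tv_dist_map_pmf_le[OF this, of "\<lambda>(F, g). F h" "\<lambda>(F, g). F g"]
  have "tv_dist (LRS_law n h t) ?U \<le> measure_pmf.prob ?r {(F, g). F h \<noteq> F g}"
    unfolding 1 2 by (simp add: case_prod_beta')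
  also have "\<dots> \<le> measure_pmf.prob ?r (fst -` {F. F hi \<noteq> F lo})"
  proof (rule measure_pmf.finite_measure_mono_AE)
    show "AE x in ?r. x \<in> {(F, g). F h \<noteq> F g} \<longrightarrow> x \<in> fst -` {F. F hi \<noteq> F lo}"
    proof (subst AE_measure_pmf_iff, intro ballI impI)
      fix x assume x: "x \<in> set_pmf ?r" "x \<in> {(F, g). F h \<noteq> F g}"
      then obtain F g where Fg: "x = (F, g)" "F \<in> set_pmf (flow n t)" "g \<in> path_families n" "F h \<noteq> F g"
        using supp by auto
      have "F lo \<le> F f \<and> F f \<le> F hi" if "f \<in> path_families n" for f
        using flow_mono[OF n Fg(2)] that lo hi by blast
      then have "F hi \<noteq> F lo" using Fg(3,4) h by (metis order_antisym)
      then show "x \<in> fst -` {F. F hi \<noteq> F lo}" using Fg(1) by simp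
    qed
  qed simp
  also have "\<dots> = measure_pmf.prob (map_pmf fst ?r) {F. F hi \<noteq> F lo}" by simp
  finally show ?thesis by (simp only: map_fst_pair_pmf)
qed

section \<open>Extreme families and bounds on the area\<close>

lemma path_families_lipschitz:
  assumes "h \<in> path_families n" "i < n" "x \<le> y" "y \<le> 2 * n"
  shows "\<bar>h i y - h i x\<bar> \<le> (real y - real x) / 2"
  using assms(3,4)
proof (induction y rule: dec_induct)
  case (step k)
  then have "\<bar>h i k - h i x\<bar> \<le> (real k - real x) / 2" "\<bar>h i (Suc k) - h i k\<bar> \<le> 1/2"
    using path_families_step[OF assms(1,2), of k] by auto
  then show ?case
    using abs_triangle_ineq[of "h i (Suc k) - h i k" "h i k - h i x"] by (simp add: field_simps)
qed simp

text \<open>All paths are translates of one tent, so each reaches its own Lipschitz bound while they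
  stay disjoint.\<close>

definition extreme_family :: "real \<Rightarrow> nat \<Rightarrow> nat \<Rightarrow> nat \<Rightarrow> real" where
  "extreme_family s n i x = (if i < n \<and> x \<le> 2 * n then real i + s * min (real x) (2 * real n - real x) / 2 else 0)"

lemma extreme_family_in_path_families:
  assumes "s \<in> {1, - 1}"
  shows "extreme_family s n \<in> path_families n"
proof -
  have "extreme_family s n i (x + 1) = extreme_family s n i x + 1 / 2 \<or>
        extreme_family s n i (x + 1) = extreme_family s n i x - 1 / 2" if "i < n" "x < 2 * n" for i x
    using assms that by (cases "x < n") (auto simp: extreme_family_def min_def field_simps)
  then show ?thesis unfolding path_families_def by (auto simp: extreme_family_def)
qed

lemma path_families_bounds:
  assumes "h \<in> path_families n"
  shows "extreme_family (- 1) n \<le> h" "h \<le> extreme_family 1 n"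
proof -
  have bound: "\<bar>h i x - real i\<bar> \<le> min (real x) (2 * real n - real x) / 2" if "i < n" "x \<le> 2 * n" for i x
  proof -
    have ends: "h i 0 = real i" "h i (2 * n) = real i"
      using assms that by (simp_all add: path_families_def)
    have "\<bar>h i x - real i\<bar> \<le> real x / 2"
      using path_families_lipschitz[OF assms that(1), of 0 x] that ends by simp
    moreover have "\<bar>h i x - real i\<bar> \<le> (2 * real n - real x) / 2"
      using path_families_lipschitz[OF assms that(1), of x "2 * n"] that ends
      by (simp add: abs_minus_commute)
    ultimately show ?thesis by (cases "real x \<le> 2 * real n - real x") simp_all
  qed
  have "extreme_family (- 1) n i x \<le> h i x \<and> h i x \<le> extreme_family 1 n i x" for i x
  proof (cases "i < n \<and> x \<le> 2 * n")
    case True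
    let ?m = "min (real x) (2 * real n - real x)"
    from True have "extreme_family 1 n i x = real i + ?m / 2"
      "extreme_family (- 1) n i x = real i - ?m / 2"
      by (simp_all add: extreme_family_def)
    moreover have "h i x - real i \<le> ?m / 2" "real i - h i x \<le> ?m / 2"
      using bound[of i x] True unfolding abs_le_iff by simp_all
    ultimately show ?thesis by linarith
  next
    case False
    then have "h i x = 0" using assms unfolding path_families_def by blast
    then show ?thesis using False by (auto simp: extreme_family_def)
  qed
  then show "extreme_family (- 1) n \<le> h" "h \<le> extreme_family 1 n" by (auto simp: le_fun_def)
qed

lemma weighted_area_diff:
  "weighted_area n w g - weighted_area n w h = (\<Sum>x\<in>{1..<2 * n}. w x * (\<Sum>i<n. g i x - h i x))"
  by (simp add: weighted_area_def sum_subtractf right_diff_distrib)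

text \<open>Fewer than \<open>2 * n\<close> columns, \<open>n\<close> paths, a separation of at most
  \<open>n\<close> and weights at most 1. Only the exponent 3 affects the leading constant.\<close>

lemma weighted_area_extreme_diff_le:
  "weighted_area n (cos_weight \<theta> n) (extreme_family 1 n) -
   weighted_area n (cos_weight \<theta> n) (extreme_family (- 1) n) \<le> 2 * real n ^ 3"
proof -
  have "cos_weight \<theta> n x * (\<Sum>i<n. extreme_family 1 n i x - extreme_family (- 1) n i x) \<le> real n * real n"
    if x: "x \<in> {1..<2 * n}" for x
  proof -
    let ?m = "min (real x) (2 * real n - real x)"
    have m: "0 \<le> ?m" "?m \<le> real n" using x by auto
    have "(\<Sum>i<n. extreme_family 1 n i x - extreme_family (- 1) n i x) = real n * ?m"
      using x by (simp add: extreme_family_def)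
    moreover have "cos_weight \<theta> n x * (real n * ?m) \<le> 1 * (real n * real n)"
      using m by (intro mult_mono) (auto simp: cos_weight_def)
    ultimately show ?thesis by simp
  qed
  then have "weighted_area n (cos_weight \<theta> n) (extreme_family 1 n) -
      weighted_area n (cos_weight \<theta> n) (extreme_family (- 1) n) \<le> (\<Sum>x\<in>{1..<2 * n}. real n * real n)"
    unfolding weighted_area_diff by (rule sum_mono)
  also have "\<dots> \<le> (2 * real n) * (real n * real n)"
    by (simp, intro mult_right_mono) auto
  finally show ?thesis by (simp add: power3_eq_cube)
qed

text \<open>By parity, distinct ordered families differ by at least 1 at some internal point, whose
  weight is at least \<open>cos \<theta>\<close>; all other terms are nonnegative.\<close>

lemma weighted_area_separation:
  assumes \<theta>: "0 < \<theta>" "\<theta> < pi / 2"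
    and h: "h \<in> path_families n" and g: "g \<in> path_families n" and le: "h \<le> g"
  shows "cos \<theta> * of_bool (g \<noteq> h) \<le> weighted_area n (cos_weight \<theta> n) g - weighted_area n (cos_weight \<theta> n) h"
proof -
  let ?w = "cos_weight \<theta> n"
  have le': "h i x \<le> g i x" for i x using le by (auto simp: le_fun_def)
  have w: "cos \<theta> \<le> ?w x" "0 < cos \<theta>" if "x \<le> 2 * n" for x
    using cos_weight_ge[OF \<theta> that] cos_gt_zero[of \<theta>] \<theta> by auto
  have nonneg: "0 \<le> ?w x * (\<Sum>i<n. g i x - h i x)" if "x \<in> {1..<2 * n}" for x
    using le' w[of x] that by (intro mult_nonneg_nonneg sum_nonneg) auto
  show ?thesis
  proof (cases "g = h")
    case True
    then show ?thesis by simp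
  next
    case False
    then obtain i x where ix: "g i x \<noteq> h i x" by (auto simp: fun_eq_iff)
    then have range: "i < n" "x \<le> 2 * n"
      using h g unfolding path_families_def by (metis (mono_tags, lifting) mem_Collect_eq)+
    moreover have "x \<noteq> 0" "x \<noteq> 2 * n"
      using ix h g range(1) unfolding path_families_def by (metis (mono_tags, lifting) mem_Collect_eq)+
    ultimately have x: "x \<in> {1..<2 * n}" by auto
    have "1 \<le> g i x - h i x"
      using path_families_diff_less[OF h g range(1,1,2)] le'[of i x] ix by auto
    also have "\<dots> \<le> (\<Sum>i<n. g i x - h i x)"
      using range(1) le' by (intro member_le_sum) auto
    finally have "cos \<theta> * 1 \<le> ?w x * (\<Sum>i<n. g i x - h i x)"
      using w[OF range(2)] by (intro mult_mono) auto
    also have "\<dots> \<le> (\<Sum>x\<in>{1..<2 * n}. ?w x * (\<Sum>i<n. g i x - h i x))"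
      using x nonneg by (intro member_le_sum) auto
    finally show ?thesis using False by (simp add: weighted_area_diff)
  qed
qed

text \<open>Markov's inequality for the area between the images of the two extreme families, which
  is at least \<open>cos \<theta>\<close> until they meet.\<close>

lemma LRS_distance_le:
  assumes n: "0 < n" and \<theta>: "0 < \<theta>" "\<theta> < pi / 2" and c: "0 \<le> contraction_factor \<theta> n"
  shows "LRS_distance n t \<le> contraction_factor \<theta> n ^ t * (2 * real n ^ 3) / cos \<theta>"
proof -
  let ?top = "extreme_family 1 n" and ?bot = "extreme_family (- 1) n"
  let ?A = "weighted_area n (cos_weight \<theta> n)" and ?E = "measure_pmf.expectation (flow n t)"
  have PF: "?top \<in> path_families n" "?bot \<in> path_families n"
    using extreme_family_in_path_families by auto
  have le: "?bot \<le> ?top" using path_families_bounds PF by blast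
  have "cos \<theta> * measure_pmf.prob (flow n t) {F. F ?top \<noteq> F ?bot} =
    ?E (\<lambda>F. cos \<theta> * indicator {F. F ?top \<noteq> F ?bot} F)" by simp
  also have "\<dots> \<le> ?E (\<lambda>F. ?A (F ?top) - ?A (F ?bot))"
  proof (rule expectation_mono_pmf_finite[OF finite_set_pmf_flow[OF n]])
    fix F assume F: "F \<in> set_pmf (flow n t)"
    show "cos \<theta> * indicator {F. F ?top \<noteq> F ?bot} F \<le> ?A (F ?top) - ?A (F ?bot)"
      using weighted_area_separation[OF \<theta> flow_in_path_families[OF n F PF(2)]
          flow_in_path_families[OF n F PF(1)] flow_mono[OF n F PF(2,1) le]]
      by (simp add: indicator_def of_bool_def)
  qed
  also have "\<dots> \<le> contraction_factor \<theta> n ^ t * (?A ?top - ?A ?bot)"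
    by (rule flow_contraction[OF n \<theta> c PF(2,1) le])
  also have "\<dots> \<le> contraction_factor \<theta> n ^ t * (2 * real n ^ 3)"
    using c by (intro mult_left_mono weighted_area_extreme_diff_le) auto
  finally have "measure_pmf.prob (flow n t) {F. F ?top \<noteq> F ?bot} \<le>
      contraction_factor \<theta> n ^ t * (2 * real n ^ 3) / cos \<theta>"
    using cos_gt_zero[of \<theta>] \<theta> by (simp add: pos_le_divide_eq mult.commute)
  moreover have "tv_dist (LRS_law n h t) (pmf_of_set (path_families n)) \<le>
      measure_pmf.prob (flow n t) {F. F ?top \<noteq> F ?bot}" if "h \<in> path_families n" for h
    by (rule tv_dist_LRS_law_le[OF n that PF(2) path_families_bounds(1) PF(1) path_families_bounds(2)])
  ultimately show ?thesis
    unfolding LRS_distance_def using path_families_finite path_families_nonempty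
    by (intro Max.boundedI) (auto intro: order_trans)
qed

section \<open>Asymptotics of the mixing time\<close>

theorem mainTheorem5:
  fixes \<epsilon> \<delta> :: real
  assumes "0 < \<epsilon>" and "\<epsilon> < 1" and "0 < \<delta>"
  shows "\<exists>L::nat. \<forall>n\<ge>L. \<forall>t::nat.
           real t \<ge> (48 + \<delta>) / pi\<^sup>2 * real n ^ 4 * ln (real n) \<longrightarrow> LRS_distance n t \<le> \<epsilon>"
proof -
  \<comment> \<open>As \<open>48 + \<delta> = 16 * (3 + \<delta> / 16)\<close>, this ratio lowers
    the limiting exponent of decay only to \<open>3 + \<delta> / 32\<close>, still above the 3 of
    \<open>n^3\<close>, and keeps \<open>\<theta>\<close> strictly below
    \<open>pi / 2\<close>.\<close>
  define r where "r = (3 + \<delta> / 32) / (3 + \<delta> / 16)"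
  have r: "0 < r" "r < 1" using assms by (auto simp: r_def)
  define \<theta> where "\<theta> = pi / 2 * sqrt r"
  have \<theta>: "0 < \<theta>" "\<theta> < pi / 2" using r by (auto simp: \<theta>_def)
  have \<theta>2: "\<theta>\<^sup>2 = pi\<^sup>2 / 4 * r" using r by (simp add: \<theta>_def power_mult_distrib power_divide)
  \<comment> \<open>At the threshold time, with \<open>n * (2 * n - 1)\<close> replaced by its bound
    \<open>2 * n^2\<close>, time multiplied by decay rate is \<open>b n * ln n\<close>.\<close>
  define b where "b n = (48 + \<delta>) / (2 * pi\<^sup>2) * (real n ^ 2 * (1 - cos (\<theta> / real n)))" for n :: nat
  have "(\<lambda>n::nat. real n ^ 2 * (1 - cos (\<theta> / real n))) \<longlonglongrightarrow> \<theta>\<^sup>2 / 2"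
    unfolding power2_eq_square[of \<theta>] by real_asymp
  then have "b \<longlonglongrightarrow> (48 + \<delta>) / (2 * pi\<^sup>2) * (\<theta>\<^sup>2 / 2)"
    unfolding b_def by (rule tendsto_mult_left)
  also have "(48 + \<delta>) / (2 * pi\<^sup>2) * (\<theta>\<^sup>2 / 2) = (3 + \<delta> / 16) * r"
    unfolding \<theta>2 by (simp add: field_simps)
  also have "\<dots> = 3 + \<delta> / 32" using assms by (simp add: r_def)
  \<comment> \<open>Half of the surplus \<open>\<delta> / 32\<close> is given up to pass from the
    limit to all large \<open>n\<close>; the other half has to beat the constant
    \<open>2 / cos \<theta>\<close>.\<close>
  finally have "\<forall>\<^sub>F n in sequentially. 3 + \<delta> / 64 < b n"
    using assms by (intro order_tendstoD) auto
  moreover have "(\<lambda>n::nat. 2 / cos \<theta> * real n powr (- (\<delta> / 64))) \<longlonglongrightarrow> 2 / cos \<theta> * 0"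
    using assms by (intro tendsto_mult_left tendsto_neg_powr filterlim_real_sequentially) auto
  then have "\<forall>\<^sub>F n in sequentially. 2 / cos \<theta> * real n powr (- (\<delta> / 64)) < \<epsilon>"
    using assms by (intro order_tendstoD) auto
  ultimately have "\<forall>\<^sub>F n in sequentially. 3 + \<delta> / 64 < b n \<and>
      2 / cos \<theta> * real n powr (- (\<delta> / 64)) < \<epsilon> \<and> 2 \<le> n"
    using eventually_ge_at_top[of 2] by eventually_elim auto
  then obtain L where L: "\<And>n. L \<le> n \<Longrightarrow> 3 + \<delta> / 64 < b n \<and>
      2 / cos \<theta> * real n powr (- (\<delta> / 64)) < \<epsilon> \<and> 2 \<le> n"
    unfolding eventually_sequentially by blast
  have "LRS_distance n t \<le> \<epsilon>"
    if "L \<le> n" and t: "real t \<ge> (48 + \<delta>) / pi\<^sup>2 * real n ^ 4 * ln (real n)" for n t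
  proof -
    have n: "2 \<le> n" "0 < n" and bn: "3 + \<delta> / 64 < b n"
      and small: "2 / cos \<theta> * real n powr (- (\<delta> / 64)) < \<epsilon>"
      using L[OF that(1)] by auto
    let ?N = "real n * (2 * real n - 1)" and ?v = "1 - cos (\<theta> / real n)"
    have v: "0 \<le> ?v" "?v \<le> 2" using cos_ge_minus_one[of "\<theta> / real n"] by auto
    have N: "2 \<le> ?N" "?N \<le> 2 * real n ^ 2"
    proof -
      have "2 * 1 \<le> ?N" using n by (intro mult_mono) auto
      then show "2 \<le> ?N" by simp
      show "?N \<le> 2 * real n ^ 2" by (simp add: algebra_simps power2_eq_square)
    qed
    have cf: "contraction_factor \<theta> n = 1 - ?v / ?N" by (simp add: contraction_factor_def)
    \<comment> \<open>The bound \<open>2 \<le> n\<close> built into \<open>L\<close> is used here: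
      \<open>?v \<le> 2 \<le> ?N\<close> makes the contraction factor nonnegative.\<close>
    have "?v \<le> ?N" using v(2) N(1) by linarith
    then have c: "0 \<le> contraction_factor \<theta> n" using N(1) by (simp add: cf)
    have ln: "0 \<le> ln (real n)" using n by simp
    have "(3 + \<delta> / 64) * ln (real n) \<le> b n * ln (real n)"
      using bn ln by (intro mult_right_mono) auto
    also have "\<dots> = ((48 + \<delta>) / pi\<^sup>2 * real n ^ 4 * ln (real n)) * (?v / (2 * real n ^ 2))"
      using n by (simp add: b_def field_simps power4_eq_xxxx power2_eq_square)
    also have "\<dots> \<le> real t * (?v / (2 * real n ^ 2))"
      using t v by (intro mult_right_mono) auto
    also have "\<dots> \<le> real t * (?v / ?N)"
      using v N n by (intro mult_left_mono divide_left_mono mult_pos_pos) auto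
    finally have tN: "(3 + \<delta> / 64) * ln (real n) \<le> real t * (?v / ?N)" .
    have "contraction_factor \<theta> n ^ t \<le> exp (- (?v / ?N)) ^ t"
      using c exp_ge_add_one_self[of "- (?v / ?N)"] by (intro power_mono) (auto simp: cf)
    also have "\<dots> = exp (- (real t * (?v / ?N)))"
      by (simp add: exp_of_nat_mult[symmetric])
    also have "\<dots> \<le> exp (- ((3 + \<delta> / 64) * ln (real n)))" using tN by simp
    also have "\<dots> = real n powr (- (\<delta> / 64) - 3)"
      using n by (simp add: powr_def algebra_simps)
    also have "\<dots> = real n powr (- (\<delta> / 64)) / real n ^ 3"
      using n by (simp add: powr_diff)
    finally have "contraction_factor \<theta> n ^ t * (2 * real n ^ 3) \<le>
        real n powr (- (\<delta> / 64)) / real n ^ 3 * (2 * real n ^ 3)"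
      by (rule mult_right_mono) simp
    also have "\<dots> = 2 * real n powr (- (\<delta> / 64))" using n by simp
    finally have "contraction_factor \<theta> n ^ t * (2 * real n ^ 3) / cos \<theta> \<le>
        2 * real n powr (- (\<delta> / 64)) / cos \<theta>"
      using cos_gt_zero[of \<theta>] \<theta> by (intro divide_right_mono) auto
    then show ?thesis
      using LRS_distance_le[OF n(2) \<theta> c, of t] small by simp
  qed
  then show ?thesis by blast
qed

end
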